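(* Let $G$ be a connected graph of order $n\geq 4$ and diameter $2$. Then \[ \xi^c(G)\le 2n^2-4n-2(n\bmod 2), \] with equality if and only if $G\simeq M_n$, or $n=5$ and $G\simeq H_1$.
   Context: All graphs are simple, finite, undirected. For a connected graph $G=(V,E)$, $\mathrm{dist}(u,v)$ is the number of edges of a shortest $u$–$v$ path, the eccentricity of $v$ is $\mathrm{ecc}(v)=\max_{w\in V}\mathrm{dist}(v,w)$, the diameter is the maximum eccentricity, and the eccentric connectivity index is $\xi^c(G)=\sum_{v\in V}\deg(v)\,\mathrm{ecc}(v)$. $M_n$ denotes the graph obtained from the complete graph $K_n$ by removing a maximum matching (i.e. $\lfloor n/2\rfloor$ pairwise disjoint edges) and, if $n$ is odd, additionally removing one edge incident to the unique vertex that still has degree $n-1$; thus every vertex of $M_n$ has degree $n-2$, except possibly one of degree $n-3$. $H_1$ is the wheel on $5$ vertices: a cycle on $4$ vertices together with a fifth vertex adjacent to all four cycle vertices. *)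

theory Defs
  imports "Graph_Theory.Digraph_Component" "Graph_Theory.Digraph_Isomorphism"
begin

text \<open>
  Simple finite undirected graphs are the symmetric, loop-free digraphs without parallel
  arcs of the locale \<^locale>\<open>graph\<close>: an edge is a pair of opposite arcs, so the degree of
  a vertex is its \<^const>\<open>out_degree\<close>.
\<close>

text \<open>
  Number of edges of a shortest path. The value is unspecified if \<open>v\<close> is not reachable
  from \<open>u\<close>, so this notion and those built on it are meaningful for connected graphs only.
\<close>

definition graph_dist :: "('a,'b) pre_digraph \<Rightarrow> 'a \<Rightarrow> 'a \<Rightarrow> nat" where
  "graph_dist G u v = (LEAST k. \<exists>p. pre_digraph.apath G u p v \<and> length p = k)"

definition eccentricity :: "('a,'b) pre_digraph \<Rightarrow> 'a \<Rightarrow> nat" where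
  "eccentricity G v = Max (graph_dist G v ` verts G)"

definition graph_diameter :: "('a,'b) pre_digraph \<Rightarrow> nat" where
  "graph_diameter G = Max (eccentricity G ` verts G)"

definition eccentric_connectivity_index :: "('a,'b) pre_digraph \<Rightarrow> nat" where
  "eccentric_connectivity_index G = (\<Sum>v\<in>verts G. out_degree G v * eccentricity G v)"

text \<open>
  The vertices are \<open>0, \<dots>, n - 1\<close> and the removed maximum matching consists of the edges
  \<open>{2 i, 2 i + 1}\<close>. If \<open>n\<close> is odd, the matching misses \<open>n - 1\<close>, and the edge \<open>{0, n - 1}\<close>
  is removed as well. Other choices of the matching and of the last edge give isomorphic
  graphs.
\<close>

definition M_matching :: "nat \<Rightarrow> nat rel" where
  "M_matching n = (\<Union>i<n div 2. {(2 * i, 2 * i + 1), (2 * i + 1, 2 * i)})"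

definition M_extra :: "nat \<Rightarrow> nat rel" where
  "M_extra n = (if odd n then {(0, n - 1), (n - 1, 0)} else {})"

definition M_graph :: "nat \<Rightarrow> nat pair_pre_digraph" where
  "M_graph n =
    \<lparr> pverts = {..<n},
      parcs = {(u, v). u < n \<and> v < n \<and> u \<noteq> v} - M_matching n - M_extra n \<rparr>"

text \<open>The wheel: rim \<open>0, 1, 2, 3\<close> and hub \<open>4\<close>.\<close>

definition H1_graph :: "nat pair_pre_digraph" where
  "H1_graph =
    (let E = {(0, 1), (1, 2), (2, 3), (3, 0)} \<union> {(4, 0), (4, 1), (4, 2), (4, 3)}
     in \<lparr> pverts = {..<5}, parcs = E \<union> E\<inverse> \<rparr>)"

end

theory Submission
  imports Defs
begin

text \<open>
  In a graph of diameter 2 on \<open>n\<close> vertices, a vertex with \<open>c\<close> non-neighbours contributes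
  \<open>n - 1\<close> if \<open>c = 0\<close> and \<open>2 (n - 1 - c)\<close> otherwise. Compared with the value \<open>2 (n - 2)\<close> it thus
  loses \<open>n - 3\<close> or \<open>2 (c - 1)\<close>, never a negative amount. If no vertex is dominating, the total
  loss is twice the excess of the degree sum of the complement over \<open>n\<close>, which is odd when \<open>n\<close> is.
  So the loss is minimal exactly when the complement is a perfect matching (\<open>n\<close> even), a matching
  with one component replaced by a path on three vertices (\<open>n\<close> odd), or a matching and one isolated
  vertex with \<open>n - 3 = 2\<close>.
\<close>

section \<open>Perfect matchings\<close>

text \<open>The partner of \<open>k\<close> in the pairing {0, 1}, {2, 3}, ... that underlies
  \<open>M_matching\<close>. The subtraction is never truncated, since it is applied to odd numbers
  only.\<close>

definition mate :: "nat \<Rightarrow> nat" where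
  "mate k = (if even k then k + 1 else k - 1)"

lemma mate_simps [simp]: "mate 0 = Suc 0" "mate (Suc 0) = 0"
    "mate (Suc (Suc k)) = Suc (Suc (mate k))"
  by (auto simp: mate_def)

text \<open>Induction on the size of \<open>V\<close>, removing one orbit \<open>{d, g d}\<close> at
  a time: the orbit gets the numbers 0 and 1, and the numbering of the rest is shifted by 2, which
  commutes with \<open>mate\<close>. The vertex \<open>c\<close> can be prescribed as number 0
  because the edge in \<open>M_extra\<close> is attached to that vertex.\<close>

lemma involution_enumeration:
  fixes g :: "'a \<Rightarrow> 'a"
  assumes "finite V" "g ` V \<subseteq> V" "\<And>v. v \<in> V \<Longrightarrow> g v \<noteq> v" "\<And>v. v \<in> V \<Longrightarrow> g (g v) = v"
  shows "even (card V) \<and> (\<exists>f. bij_betw f V {..<card V} \<and> (\<forall>v\<in>V. f (g v) = mate (f v))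
    \<and> (c \<in> V \<longrightarrow> f c = 0))"
  using assms
proof (induction "card V" arbitrary: V c rule: less_induct)
  case less
  show ?case
  proof (cases "V = {}")
    case True
    then show ?thesis by (auto simp: bij_betw_def)
  next
    case False
    \<comment> \<open>The first orbit is that of \<open>c\<close> if \<open>c\<close> lies in
      \<open>V\<close>, and an arbitrary one otherwise.\<close>
    then obtain d where d: "d \<in> V" "c \<in> V \<longrightarrow> d = c" by auto
    define W where "W = V - {d, g d}"
    have gd: "g d \<in> V" "g d \<noteq> d" "g (g d) = d" using less.prems d by auto
    have VW: "V = insert d (insert (g d) W)" "d \<notin> W" "g d \<notin> W"
      using d gd by (auto simp: W_def)
    have fW: "finite W" using less.prems by (simp add: W_def)
    have cV: "card V = Suc (Suc (card W))"
      using VW fW gd(2) by simp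
    have gW: "g v \<in> W" if "v \<in> W" for v
    proof -
      have "v \<in> V" "v \<noteq> d" "v \<noteq> g d" using that by (auto simp: W_def)
      then have "g v \<in> V" "g (g v) = v" using less.prems by auto
      then show ?thesis
        using \<open>v \<noteq> d\<close> \<open>v \<noteq> g d\<close> gd by (auto simp: W_def)
    qed
    \<comment> \<open>The prescribed vertex of the induction hypothesis is taken to be
      \<open>d\<close>, which is outside \<open>W\<close>, so nothing is demanded of number 0
      there.\<close>
    have "even (card W) \<and> (\<exists>f. bij_betw f W {..<card W} \<and> (\<forall>v\<in>W. f (g v) = mate (f v))
      \<and> (d \<in> W \<longrightarrow> f d = 0))"
      by (rule less.hyps) (use cV fW gW less.prems in \<open>auto simp: W_def\<close>)
    then obtain f where ev: "even (card W)" and f: "bij_betw f W {..<card W}"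
      "\<forall>v\<in>W. f (g v) = mate (f v)"
      by blast
    define h where "h v = (if v = d then 0 else if v = g d then Suc 0 else Suc (Suc (f v)))" for v
    have hW: "h v = Suc (Suc (f v))" if "v \<in> W" for v
      using that VW by (auto simp: h_def)
    have hd: "h d = 0" "h (g d) = Suc 0" using gd by (auto simp: h_def)
    have "inj_on h V"
      unfolding VW(1) using f(1) hW hd VW gd(2) by (auto simp: inj_on_def bij_betw_def)
    moreover have "h ` V = {..<card V}"
    proof -
      have "h ` W = (\<lambda>k. Suc (Suc k)) ` f ` W" using hW by (auto simp: image_image)
      also have "f ` W = {..<card W}" using f by (simp add: bij_betw_def)
      finally show ?thesis
        unfolding cV by (simp add: VW(1) hd lessThan_Suc_eq_insert_0 image_image)
    qed
    ultimately have "bij_betw h V {..<card V}" by (simp add: bij_betw_def)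
    moreover have "h (g v) = mate (h v)" if "v \<in> V" for v
      using that hW hd gW f(2) gd unfolding VW(1) by auto
    moreover have "c \<in> V \<longrightarrow> h c = 0" using d hd by auto
    ultimately show ?thesis using ev cV by auto
  qed
qed

text \<open>Swapping the components is an involution on \<open>N\<close>, and irreflexivity rules
  out fixed points.\<close>

lemma even_card_symmetric_irreflexive:
  assumes "finite N" "sym N" "irrefl N"
  shows "even (card N)"
proof -
  have "prod.swap ` N \<subseteq> N" using assms(2) by (auto dest: symD)
  moreover have "prod.swap e \<noteq> e" if "e \<in> N" for e
    using that assms(3) by (cases e) (auto simp: irrefl_def)
  ultimately show ?thesis using involution_enumeration[of N prod.swap undefined] assms(1) by simp
qed

text \<open>Since each row of \<open>N\<close> is a singleton, \<open>N\<close> is the graph of a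
  function \<open>g\<close>. Symmetry makes \<open>g\<close> an involution and irreflexivity makes
  it free of fixed points; injectivity of the numbering then turns \<open>f v = f (g u)\<close> back
  into \<open>v = g u\<close>.\<close>

lemma perfect_matching_enumeration:
  assumes "finite V" "N \<subseteq> V \<times> V" "sym N" "irrefl N" "\<forall>v\<in>V. card (N `` {v}) = 1"
  shows "even (card V)"
    "\<exists>f. bij_betw f V {..<card V} \<and> (\<forall>u\<in>V. \<forall>v\<in>V. (u, v) \<in> N \<longleftrightarrow> f v = mate (f u))
      \<and> (c \<in> V \<longrightarrow> f c = 0)"
proof -
  have "\<forall>v\<in>V. \<exists>w. N `` {v} = {w}" using assms(5) by (simp add: card_1_singleton_iff)
  then obtain g where g: "\<forall>v\<in>V. N `` {v} = {g v}" by metis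
  have iff: "(u, v) \<in> N \<longleftrightarrow> v = g u" if "u \<in> V" for u v using g that by blast
  have gV: "g v \<in> V" if "v \<in> V" for v using iff[OF that] assms(2) by blast
  have "even (card V) \<and> (\<exists>f. bij_betw f V {..<card V} \<and> (\<forall>v\<in>V. f (g v) = mate (f v))
    \<and> (c \<in> V \<longrightarrow> f c = 0))"
  proof (rule involution_enumeration)
    show "finite V" by fact
    show "g ` V \<subseteq> V" using gV by auto
    show "g v \<noteq> v" if "v \<in> V" for v
      using iff[OF that] assms(4) by (metis irrefl_def)
    show "g (g v) = v" if "v \<in> V" for v
      using iff[OF that] iff[OF gV[OF that]] assms(3) by (metis symD)
  qed
  then obtain f where f: "even (card V)" "bij_betw f V {..<card V}" "\<forall>v\<in>V. f (g v) = mate (f v)"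
    "c \<in> V \<longrightarrow> f c = 0" by blast
  show "even (card V)" by fact
  have "(u, v) \<in> N \<longleftrightarrow> f v = mate (f u)" if "u \<in> V" "v \<in> V" for u v
    using iff[OF that(1)] f(2,3) gV[OF that(1)] that
    by (metis bij_betw_def inj_on_contraD)
  then show "\<exists>f. bij_betw f V {..<card V} \<and> (\<forall>u\<in>V. \<forall>v\<in>V. (u, v) \<in> N \<longleftrightarrow> f v = mate (f u))
      \<and> (c \<in> V \<longrightarrow> f c = 0)"
    using f by blast
qed

text \<open>The vertices other than \<open>b\<close> are perfectly matched and numbered first;
  \<open>b\<close> receives the last number. This serves both the unmatched vertex of
  \<open>M_graph\<close> for odd order and the hub of the wheel.\<close>

lemma near_perfect_matching_enumeration:
  assumes "finite V" "N \<subseteq> V \<times> V" "sym N" "irrefl N" "b \<in> V" "N `` {b} = {}"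
    "\<forall>v\<in>V - {b}. card (N `` {v}) = 1"
  shows "\<exists>f. bij_betw f V {..<card V} \<and> f b = card V - 1 \<and> odd (card V) \<and>
     (\<forall>u\<in>V. \<forall>v\<in>V. (u, v) \<in> N \<longleftrightarrow> u \<noteq> b \<and> v \<noteq> b \<and> f v = mate (f u))
      \<and> (c \<in> V - {b} \<longrightarrow> f c = 0)"
proof -
  let ?W = "V - {b}"
  have b: "(b, v) \<notin> N" "(v, b) \<notin> N" for v using assms(3,6) by (auto dest: symD)
  have sub: "N \<subseteq> ?W \<times> ?W" using assms(2) b by auto
  note pm = perfect_matching_enumeration[OF _ sub assms(3,4,7)]
  obtain f where f: "bij_betw f ?W {..<card ?W}"
    "\<forall>u\<in>?W. \<forall>v\<in>?W. (u, v) \<in> N \<longleftrightarrow> f v = mate (f u)" "c \<in> ?W \<longrightarrow> f c = 0"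
    using pm(2)[of c] assms(1) by auto
  have ev: "even (card ?W)" using pm(1) assms(1) by simp
  have cV: "card V = Suc (card ?W)" using assms(1,5) by (rule card.remove)
  define h where "h = f(b := card ?W)"
  have hb: "h b = card ?W" by (simp add: h_def)
  have "bij_betw h ?W {..<card ?W}"
    using f(1) by (subst bij_betw_cong[where g = f]) (auto simp: h_def)
  then have "bij_betw h (?W \<union> {b}) ({..<card ?W} \<union> {h b})"
    by (intro notIn_Un_bij_betw) (auto simp: hb)
  moreover have "?W \<union> {b} = V" using assms(5) by auto
  moreover have "{..<card ?W} \<union> {h b} = {..<card V}" unfolding cV hb by auto
  ultimately have "bij_betw h V {..<card V}" by simp
  moreover have "(u, v) \<in> N \<longleftrightarrow> u \<noteq> b \<and> v \<noteq> b \<and> h v = mate (h u)" if "u \<in> V" "v \<in> V" for u v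
    using f(2) b that by (auto simp: h_def)
  ultimately show ?thesis
    using f(3) ev cV by (intro exI[of _ h]) (auto simp: h_def)
qed

section \<open>Minimal loss\<close>

text \<open>The shortfall of degree times eccentricity below \<open>2 * (n - 2)\<close>: degree
  \<open>n - 1\<close> and eccentricity 1 if \<open>c = 0\<close>, degree \<open>n - 1 - c\<close>
  and eccentricity 2 otherwise.\<close>

definition loss :: "nat \<Rightarrow> nat \<Rightarrow> int" where
  "loss n c = (if c = 0 then int n - 3 else 2 * (int c - 1))"

lemma loss_nonneg: "n \<ge> 4 \<Longrightarrow> 0 \<le> loss n c"
  by (simp add: loss_def)

text \<open>From order 4 on, a dominating vertex has the positive loss \<open>n - 3\<close>.\<close>

lemma loss_eq_0_iff: "n \<ge> 4 \<Longrightarrow> loss n c = 0 \<longleftrightarrow> c = 1"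
  by (auto simp: loss_def)

text \<open>\<open>N\<close> is the disjoint union of its rows. With ordered pairs,
  \<open>card N\<close> is thus the degree sum, twice the number of edges.\<close>

lemma card_eq_sum_Image:
  assumes "finite V" "N \<subseteq> V \<times> V"
  shows "card N = (\<Sum>v\<in>V. card (N `` {v}))"
proof -
  have "N = Sigma V (\<lambda>v. N `` {v})" using assms(2) by auto
  moreover have "finite (N `` {v})" for v
    by (rule finite_subset[OF _ assms(1)]) (use assms(2) in auto)
  ultimately show ?thesis using assms(1) card_SigmaI[of V "\<lambda>v. N `` {v}"] by metis
qed

lemma sum_loss_no_isolated:
  assumes "finite V" "N \<subseteq> V \<times> V" "\<forall>v\<in>V. card (N `` {v}) \<noteq> 0"
  shows "(\<Sum>v\<in>V. loss n (card (N `` {v}))) = 2 * (int (card N) - int (card V))"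
proof -
  have "(\<Sum>v\<in>V. loss n (card (N `` {v}))) = (\<Sum>v\<in>V. 2 * (int (card (N `` {v})) - 1))"
    using assms(3) by (intro sum.cong) (auto simp: loss_def)
  also have "\<dots> = 2 * ((\<Sum>v\<in>V. int (card (N `` {v}))) - int (card V))"
    by (simp add: sum_distrib_left[symmetric] sum_subtractf)
  finally show ?thesis using card_eq_sum_Image[OF assms(1,2)] by simp
qed

text \<open>\<open>N\<close> plays the role of the adjacency relation of the complement. For even
  \<open>n\<close> the bound is mere nonnegativity. For odd \<open>n\<close> either some vertex has
  an empty row and alone loses \<open>n - 3\<close>, or the total loss is twice the difference of
  the even \<open>card N\<close> and the odd \<open>n\<close>.\<close>

lemma sum_loss_extremal:
  assumes "finite V" "N \<subseteq> V \<times> V" "sym N" "irrefl N" "card V = n" "n \<ge> 4"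
  defines "L \<equiv> (\<Sum>v\<in>V. loss n (card (N `` {v})))"
  shows "2 * (int n mod 2) \<le> L"
    and "L = 2 * (int n mod 2) \<Longrightarrow>
      even n \<and> (\<forall>v\<in>V. card (N `` {v}) = 1)
      \<or> odd n \<and> (\<exists>z\<in>V. card (N `` {z}) = 2 \<and> (\<forall>v\<in>V - {z}. card (N `` {v}) = 1))
      \<or> n = 5 \<and> (\<exists>z\<in>V. card (N `` {z}) = 0 \<and> (\<forall>v\<in>V - {z}. card (N `` {v}) = 1))"
proof -
  let ?c = "\<lambda>v. card (N `` {v})"
  have ge0: "0 \<le> loss n (?c v)" for v using loss_nonneg[OF assms(6)] .
  \<comment> \<open>Isolating the term of one exceptional vertex \<open>z\<close>; in the equality
    cases it exhausts the whole loss, and \<open>restD\<close> settles all other vertices.\<close>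
  have split: "L = loss n (?c z) + (\<Sum>v\<in>V - {z}. loss n (?c v))" if "z \<in> V" for z
    unfolding L_def using that assms(1) by (rule sum.remove[rotated])
  have rest0: "0 \<le> (\<Sum>v\<in>V - {z}. loss n (?c v))" for z using ge0 by (simp add: sum_nonneg)
  have restD: "\<forall>v\<in>V - {z}. ?c v = 1" if "(\<Sum>v\<in>V - {z}. loss n (?c v)) = 0" for z
    using that sum_nonneg_eq_0_iff[of "V - {z}" "\<lambda>v. loss n (?c v)"] ge0 assms(1)
      loss_eq_0_iff[OF assms(6)] by auto
  have L0: "L = 0 \<longleftrightarrow> (\<forall>v\<in>V. ?c v = 1)"
    unfolding L_def using sum_nonneg_eq_0_iff[of V "\<lambda>v. loss n (?c v)"] ge0 assms(1)
      loss_eq_0_iff[OF assms(6)] by auto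
  have "finite N" using assms(1,2) by (meson finite_SigmaI finite_subset)
  then have evN: "even (card N)" using assms(3,4) by (rule even_card_symmetric_irreflexive)
  have ge: "2 * (int n mod 2) \<le> L \<and> (L = 2 * (int n mod 2) \<longrightarrow>
      even n \<and> (\<forall>v\<in>V. card (N `` {v}) = 1)
      \<or> odd n \<and> (\<exists>z\<in>V. card (N `` {z}) = 2 \<and> (\<forall>v\<in>V - {z}. card (N `` {v}) = 1))
      \<or> n = 5 \<and> (\<exists>z\<in>V. card (N `` {z}) = 0 \<and> (\<forall>v\<in>V - {z}. card (N `` {v}) = 1)))"
  proof (cases "even n")
    case True
    then have "int n mod 2 = 0" by presburger
    moreover have "0 \<le> L" unfolding L_def using ge0 by (simp add: sum_nonneg)
    ultimately show ?thesis using L0 True by auto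
  next
    case False
    then have m: "int n mod 2 = 1" by presburger
    \<comment> \<open>Oddness excludes order 4, so a dominating vertex loses at least 2, with
      equality for order 5 only.\<close>
    have n5: "n \<ge> 5" using False assms(6) by presburger
    show ?thesis
    proof (cases "\<exists>z\<in>V. ?c z = 0")
      case True
      then obtain z where z: "z \<in> V" "?c z = 0" by auto
      have l: "loss n (?c z) = int n - 3" using z by (simp add: loss_def)
      show ?thesis
      proof (intro conjI impI)
        show "2 * (int n mod 2) \<le> L" using split[OF z(1)] rest0[of z] l n5 m by linarith
        assume "L = 2 * (int n mod 2)"
        then have "int n = 5" "(\<Sum>v\<in>V - {z}. loss n (?c v)) = 0"
          using split[OF z(1)] rest0[of z] l n5 m by linarith+
        then show "even n \<and> (\<forall>v\<in>V. card (N `` {v}) = 1)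
            \<or> odd n \<and> (\<exists>z\<in>V. card (N `` {z}) = 2 \<and> (\<forall>v\<in>V - {z}. card (N `` {v}) = 1))
            \<or> n = 5 \<and> (\<exists>z\<in>V. card (N `` {z}) = 0 \<and> (\<forall>v\<in>V - {z}. card (N `` {v}) = 1))"
          using restD[of z] z by auto
      qed
    next
      case none: False
      have L: "L = 2 * (int (card N) - int n)"
        unfolding L_def using sum_loss_no_isolated[OF assms(1,2)] none assms(5) by auto
      have "L \<ge> 0" unfolding L_def using ge0 by (simp add: sum_nonneg)
      then have "card N \<ge> n" using L by simp
      \<comment> \<open>Parity: \<open>card N\<close> is even and \<open>n\<close> is odd, so they
        differ.\<close>
      then have "card N \<ge> n + 1" using evN False by (cases "card N = n") auto
      moreover have "odd n \<and> (\<exists>z\<in>V. ?c z = 2 \<and> (\<forall>v\<in>V - {z}. ?c v = 1))" if L2: "L = 2"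
      proof -
        \<comment> \<open>A vertex with at least two non-neighbours must exist. It loses at least 2,
          which is already everything, so it has exactly two.\<close>
        have "\<not> (\<forall>v\<in>V. ?c v = 1)" using L0 L2 by simp
        then obtain z where z: "z \<in> V" "?c z \<noteq> 1" by auto
        have "?c z \<ge> 2" using none z by (metis One_nat_def less_2_cases not_le_imp_less)
        then have l: "loss n (?c z) = 2 * (int (?c z) - 1)" by (simp add: loss_def)
        have "?c z = 2"
          using split[OF z(1)] rest0[of z] L2 l \<open>?c z \<ge> 2\<close> by presburger
        moreover have "(\<Sum>v\<in>V - {z}. loss n (?c v)) = 0"
          using split[OF z(1)] L2 l \<open>?c z = 2\<close> by simp
        ultimately show ?thesis using restD[of z] z False by auto
      qed
      ultimately show ?thesis using L m by auto
    qed
  qed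
  show "2 * (int n mod 2) \<le> L" using ge by blast
  show "L = 2 * (int n mod 2) \<Longrightarrow>
      even n \<and> (\<forall>v\<in>V. card (N `` {v}) = 1)
      \<or> odd n \<and> (\<exists>z\<in>V. card (N `` {z}) = 2 \<and> (\<forall>v\<in>V - {z}. card (N `` {v}) = 1))
      \<or> n = 5 \<and> (\<exists>z\<in>V. card (N `` {z}) = 0 \<and> (\<forall>v\<in>V - {z}. card (N `` {v}) = 1))"
    using ge by blast
qed


section \<open>Eccentricities in terms of non-adjacency\<close>

text \<open>Adjacency in the complement graph. It is defined outside the locale so that it applies
  equally to \<open>G\<close> and to the concrete graphs.\<close>

definition nonadj :: "('a, 'b) pre_digraph \<Rightarrow> 'a rel" where
  "nonadj G = {(u, v). u \<in> verts G \<and> v \<in> verts G \<and> u \<noteq> v \<and> (u, v) \<notin> arcs_ends G}"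

context graph
begin

lemma nonadj_subset: "nonadj G \<subseteq> verts G \<times> verts G"
  by (auto simp: nonadj_def)

lemma sym_nonadj: "sym (nonadj G)"
  using arcs_ends_symmetric[OF sym_arcs] by (auto simp: nonadj_def intro!: symI)

lemma irrefl_nonadj: "irrefl (nonadj G)"
  by (auto simp: nonadj_def irrefl_def)

lemma arcs_ends_irrefl: "(u, u) \<notin> arcs_ends G"
  using no_loops by (auto simp: arcs_ends_conv)

text \<open>Without parallel arcs, an outgoing arc is determined by its head.\<close>

lemma out_degree_eq_card_neighbours: "out_degree G v = card (arcs_ends G `` {v})"
proof -
  have "bij_betw (head G) (out_arcs G v) (arcs_ends G `` {v})"
    unfolding bij_betw_def
  proof
    show "inj_on (head G) (out_arcs G v)"
      using no_multi_arcs by (auto simp: inj_on_def arc_to_ends_def)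
    show "head G ` out_arcs G v = arcs_ends G `` {v}"
      by (auto simp: arcs_ends_conv image_iff Image_iff)
  qed
  then show ?thesis unfolding out_degree_def by (rule bij_betw_same_card)
qed

lemma out_degree_plus_card_nonadj:
  assumes "v \<in> verts G"
  shows "out_degree G v + card (nonadj G `` {v}) + 1 = card (verts G)"
proof -
  let ?A = "arcs_ends G `` {v}" and ?N = "nonadj G `` {v}"
  have A: "?A \<subseteq> verts G" by (auto simp: arcs_ends_conv)
  have V: "verts G = insert v (?A \<union> ?N)"
    using assms A by (auto simp: nonadj_def)
  have fin: "finite (?A \<union> ?N)" by (rule finite_subset[OF _ finite_verts]) (use V in auto)
  have "v \<notin> ?A \<union> ?N" using arcs_ends_irrefl by (auto simp: nonadj_def)
  then have "card (verts G) = Suc (card (?A \<union> ?N))" using fin by (subst V) simp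
  also have "card (?A \<union> ?N) = card ?A + card ?N"
    using fin by (intro card_Un_disjoint) (auto simp: nonadj_def)
  finally show ?thesis by (simp add: out_degree_eq_card_neighbours)
qed

text \<open>Connectedness speaks of the symmetric closure; as the arcs are symmetric already,
  reachability is the same in \<open>G\<close>. The path ensures that the \<open>LEAST\<close> in
  \<open>graph_dist\<close> is attained.\<close>

lemma connected_imp_apath:
  assumes "Digraph_Component.connected G" "u \<in> verts G" "v \<in> verts G"
  shows "\<exists>p. apath u p v"
  using assms reachable_mk_symmetric_eq[OF sym_arcs]
  by (auto simp: connected_def strongly_connected_def reachable_apath[symmetric])

lemma graph_dist_eq_0_iff:
  assumes "Digraph_Component.connected G" "u \<in> verts G" "v \<in> verts G"
  shows "graph_dist G u v = 0 \<longleftrightarrow> u = v"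
proof -
  obtain p where "apath u p v" "length p = graph_dist G u v"
    using LeastI_ex[of "\<lambda>k. \<exists>p. apath u p v \<and> length p = k"] connected_imp_apath[OF assms]
    unfolding graph_dist_def by auto
  then have "u = v" if "graph_dist G u v = 0" using that by (simp add: apath_Nil_iff)
  moreover have "graph_dist G u u = 0"
    unfolding graph_dist_def by (rule Least_eq_0) (use assms(2) in \<open>auto simp: apath_Nil_iff\<close>)
  ultimately show ?thesis by auto
qed

lemma graph_dist_le_1_iff:
  assumes "Digraph_Component.connected G" "u \<in> verts G" "v \<in> verts G"
  shows "graph_dist G u v \<le> 1 \<longleftrightarrow> (u, v) \<notin> nonadj G"
proof
  obtain p where p: "apath u p v" "length p = graph_dist G u v"
    using LeastI_ex[of "\<lambda>k. \<exists>p. apath u p v \<and> length p = k"] connected_imp_apath[OF assms]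
    unfolding graph_dist_def by auto
  assume "graph_dist G u v \<le> 1"
  with p(2) consider "p = []" | a where "p = [a]"
    by (cases p; cases "tl p") auto
  then show "(u, v) \<notin> nonadj G"
    using p(1) by cases (auto simp: apath_simps nonadj_def arcs_ends_conv)
next
  assume "(u, v) \<notin> nonadj G"
  then consider "u = v" | "u \<noteq> v" "(u, v) \<in> arcs_ends G" using assms by (auto simp: nonadj_def)
  then show "graph_dist G u v \<le> 1"
  proof cases
    case 1
    then show ?thesis using graph_dist_eq_0_iff[OF assms] by simp
  next
    case 2
    then obtain a where "a \<in> arcs G" "tail G a = u" "head G a = v" by (auto simp: arcs_ends_conv)
    then have "apath u [a] v" using 2 assms by (auto simp: apath_simps)
    then show ?thesis unfolding graph_dist_def by (intro Least_le) auto
  qed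
qed

text \<open>The diameter bounds the eccentricity by 2, and a second vertex makes it at least 1. It
  is at most 1 iff \<open>v\<close> has no non-neighbour.\<close>

lemma eccentricity_diameter_2:
  assumes "Digraph_Component.connected G" "graph_diameter G = 2" "v \<in> verts G" "card (verts G) \<ge> 2"
  shows "eccentricity G v = (if card (nonadj G `` {v}) = 0 then 1 else 2)"
proof -
  have ne: "graph_dist G v ` verts G \<noteq> {}" using assms(3) by auto
  have le2: "eccentricity G v \<le> 2"
    using assms(2,3) unfolding graph_diameter_def by (metis Max_ge finite_imageI finite_verts imageI)
  have "\<exists>w\<in>verts G. w \<noteq> v"
  proof (rule ccontr)
    assume "\<not> (\<exists>w\<in>verts G. w \<noteq> v)"
    then have "verts G \<subseteq> {v}" by auto
    then have "card (verts G) \<le> card {v}" by (intro card_mono) auto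
    then show False using assms(4) by simp
  qed
  then obtain w where w: "w \<in> verts G" "w \<noteq> v" by auto
  have "graph_dist G v w \<le> eccentricity G v"
    unfolding eccentricity_def using w by (intro Max_ge) auto
  then have ge1: "eccentricity G v \<ge> 1"
    using graph_dist_eq_0_iff[OF assms(1,3) w(1)] w(2) by (cases "graph_dist G v w") auto
  have "eccentricity G v \<le> 1 \<longleftrightarrow> (\<forall>w\<in>verts G. graph_dist G v w \<le> 1)"
    unfolding eccentricity_def using ne by (subst Max_le_iff) auto
  also have "\<dots> \<longleftrightarrow> nonadj G `` {v} = {}"
    using graph_dist_le_1_iff[OF assms(1,3)] nonadj_subset by auto
  also have "\<dots> \<longleftrightarrow> card (nonadj G `` {v}) = 0"
    using finite_subset[OF _ finite_verts, of "nonadj G `` {v}"] nonadj_subset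
    by (subst card_0_eq) auto
  finally show ?thesis using le2 ge1 by auto
qed

lemma eccentric_connectivity_index_eq_loss:
  assumes "Digraph_Component.connected G" "graph_diameter G = 2" "card (verts G) = n" "n \<ge> 2"
  shows "int (eccentric_connectivity_index G)
    = 2 * (int n)\<^sup>2 - 4 * int n - (\<Sum>v\<in>verts G. loss n (card (nonadj G `` {v})))"
proof -
  have "int (out_degree G v * eccentricity G v)
      = 2 * (int n - 2) - loss n (card (nonadj G `` {v}))" if v: "v \<in> verts G" for v
  proof -
    have d: "int (out_degree G v) = int n - 1 - int (card (nonadj G `` {v}))"
      using out_degree_plus_card_nonadj[OF v] assms(3) by linarith
    have e: "eccentricity G v = (if card (nonadj G `` {v}) = 0 then 1 else 2)"
      by (rule eccentricity_diameter_2) (use assms v in auto)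
    \<comment> \<open>The deleted simp rules would rewrite \<open>card ... = 0\<close>, the
      condition on which both conditionals branch.\<close>
    show ?thesis using d by (simp add: e loss_def del: card_eq_0_iff card_0_eq)
  qed
  then have "int (eccentric_connectivity_index G)
      = (\<Sum>v\<in>verts G. 2 * (int n - 2) - loss n (card (nonadj G `` {v})))"
    unfolding eccentric_connectivity_index_def of_nat_sum by (intro sum.cong) auto
  also have "\<dots> = int n * (2 * (int n - 2)) - (\<Sum>v\<in>verts G. loss n (card (nonadj G `` {v})))"
    by (simp add: sum_subtractf assms(3))
  finally show ?thesis by (simp add: power2_eq_square algebra_simps)
qed

section \<open>Isomorphisms as numberings of the vertices\<close>

text \<open>Arcs of \<open>with_proj H\<close> are pairs of vertices, so each arc has to go to the
  pair of images of its ends; absence of parallel arcs makes this map injective.\<close>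

lemma digraph_iso_with_projI:
  assumes bij: "bij_betw f (verts G) (pverts H)" and wf: "parcs H \<subseteq> pverts H \<times> pverts H"
    and adj: "\<forall>u\<in>verts G. \<forall>v\<in>verts G. (u, v) \<in> arcs_ends G \<longleftrightarrow> (f u, f v) \<in> parcs H"
  shows "digraph_iso G (with_proj H)"
proof -
  have inj: "inj_on f (verts G)" and im: "f ` verts G = pverts H"
    using bij by (auto simp: bij_betw_def)
  let ?h = "\<lparr>iso_verts = f, iso_arcs = \<lambda>a. (f (tail G a), f (head G a)),
      iso_head = snd, iso_tail = fst\<rparr>"
  have "inj_on (\<lambda>a. (f (tail G a), f (head G a))) (arcs G)"
    using inj by (auto simp: inj_on_def arc_to_ends_def intro!: no_multi_arcs)
  then have "digraph_isomorphism ?h"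
    using inj wf_digraph by (simp add: digraph_isomorphism_def)
  moreover have "(\<lambda>a. (f (tail G a), f (head G a))) ` arcs G = parcs H"
  proof
    show "(\<lambda>a. (f (tail G a), f (head G a))) ` arcs G \<subseteq> parcs H"
      using adj wellformed in_arcs_imp_in_arcs_ends by blast
    show "parcs H \<subseteq> (\<lambda>a. (f (tail G a), f (head G a))) ` arcs G"
    proof
      fix e assume e: "e \<in> parcs H"
      then have "e \<in> f ` verts G \<times> f ` verts G" using wf im by auto
      then obtain u v where uv: "u \<in> verts G" "v \<in> verts G" "e = (f u, f v)" by auto
      then have "(u, v) \<in> arcs_ends G" using adj e by auto
      then show "e \<in> (\<lambda>a. (f (tail G a), f (head G a))) ` arcs G"
        using uv by (auto simp: arcs_ends_conv)
    qed
  qed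
  then have "with_proj H = app_iso ?h G"
    using im by (simp add: with_proj_def app_iso_def)
  ultimately show ?thesis unfolding digraph_iso_def by blast
qed

text \<open>The tail and head maps of \<open>with_proj H\<close> are \<open>fst\<close> and
  \<open>snd\<close>, so the image of an arc is determined by the images of its ends.\<close>

lemma digraph_iso_with_projD:
  assumes "digraph_iso G (with_proj H)"
  shows "\<exists>f. bij_betw f (verts G) (pverts H) \<and>
    (\<forall>u\<in>verts G. \<forall>v\<in>verts G. (u, v) \<in> arcs_ends G \<longleftrightarrow> (f u, f v) \<in> parcs H)"
proof -
  obtain h where h: "digraph_isomorphism h" and H: "with_proj H = app_iso h G"
    using assms by (auto simp: digraph_iso_def)
  have V: "pverts H = iso_verts h ` verts G" and A: "parcs H = iso_arcs h ` arcs G"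
    and t: "iso_tail h = fst" and hd: "iso_head h = snd"
    using arg_cong[OF H, of verts] arg_cong[OF H, of arcs] arg_cong[OF H, of tail]
      arg_cong[OF H, of head] by auto
  have arcs: "iso_arcs h a = (iso_verts h (tail G a), iso_verts h (head G a))" if "a \<in> arcs G" for a
    using iso_verts_tail[OF h that] iso_verts_head[OF h that] t hd by (simp add: prod_eq_iff)
  have "(u, v) \<in> arcs_ends G \<longleftrightarrow> (iso_verts h u, iso_verts h v) \<in> parcs H"
    if "u \<in> verts G" "v \<in> verts G" for u v
    using that arcs iso_verts_eq_iff[OF h] unfolding A arcs_ends_conv
    by (auto simp: image_iff)
  then show ?thesis
    using digraph_isomorphism_inj_on_verts[OF h] V
    by (intro exI[of _ "iso_verts h"]) (auto simp: bij_betw_def)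
qed

text \<open>On distinct vertices the two relations are complementary, and on the diagonal both are
  empty, so a bijection preserves one iff it preserves the other.\<close>

lemma digraph_iso_with_proj_iff_nonadj:
  assumes "parcs H \<subseteq> pverts H \<times> pverts H" "irrefl (parcs H)"
  shows "digraph_iso G (with_proj H) \<longleftrightarrow> (\<exists>f. bij_betw f (verts G) (pverts H) \<and>
    (\<forall>u\<in>verts G. \<forall>v\<in>verts G. (u, v) \<in> nonadj G \<longleftrightarrow> (f u, f v) \<in> nonadj (with_proj H)))"
proof -
  have "(\<forall>u\<in>verts G. \<forall>v\<in>verts G. (u, v) \<in> arcs_ends G \<longleftrightarrow> (f u, f v) \<in> parcs H) \<longleftrightarrow>
    (\<forall>u\<in>verts G. \<forall>v\<in>verts G. (u, v) \<in> nonadj G \<longleftrightarrow> (f u, f v) \<in> nonadj (with_proj H))"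
    if "bij_betw f (verts G) (pverts H)" for f
  proof -
    have "f u = f v \<longleftrightarrow> u = v" "f u \<in> pverts H" if "u \<in> verts G" "v \<in> verts G" for u v
      using that \<open>bij_betw f _ _\<close> by (auto simp: bij_betw_def inj_on_eq_iff)
    moreover have "(u, u) \<notin> arcs_ends G" "(w, w) \<notin> parcs H" for u w
      using arcs_ends_irrefl assms(2) by (auto simp: irrefl_def)
    ultimately have "((u, v) \<in> arcs_ends G \<longleftrightarrow> (f u, f v) \<in> parcs H) \<longleftrightarrow>
      ((u, v) \<in> nonadj G \<longleftrightarrow> (f u, f v) \<in> nonadj (with_proj H))"
      if "u \<in> verts G" "v \<in> verts G" for u v
      using that by (cases "u = v") (auto simp: nonadj_def)
    then show ?thesis by blast
  qed
  then show ?thesis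
    using digraph_iso_with_projI[OF _ assms(1)] digraph_iso_with_projD by blast
qed

lemma card_nonadj_iso:
  assumes "bij_betw f (verts G) (pverts H)" "v \<in> verts G"
    "\<forall>u\<in>verts G. \<forall>v\<in>verts G. (u, v) \<in> nonadj G \<longleftrightarrow> (f u, f v) \<in> nonadj (with_proj H)"
  shows "card (nonadj (with_proj H) `` {f v}) = card (nonadj G `` {v})"
proof -
  have "nonadj (with_proj H) `` {f v} \<subseteq> f ` verts G"
    using assms(1) by (auto simp: bij_betw_def nonadj_def)
  then have "nonadj (with_proj H) `` {f v} = f ` (nonadj G `` {v})"
    using assms(2,3) nonadj_subset by (fastforce simp: image_iff)
  moreover have "inj_on f (nonadj G `` {v})"
    using assms(1) nonadj_subset by (auto simp: bij_betw_def intro: inj_on_subset)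
  ultimately show ?thesis by (simp add: card_image)
qed

text \<open>The total loss is an isomorphism invariant, so for the converse direction it need only
  be computed on the concrete graphs.\<close>

lemma sum_loss_iso:
  assumes "digraph_iso G (with_proj H)" "parcs H \<subseteq> pverts H \<times> pverts H" "irrefl (parcs H)"
  shows "(\<Sum>v\<in>verts G. loss n (card (nonadj G `` {v})))
    = (\<Sum>i\<in>pverts H. loss n (card (nonadj (with_proj H) `` {i})))"
proof -
  obtain f where f: "bij_betw f (verts G) (pverts H)"
    "\<forall>u\<in>verts G. \<forall>v\<in>verts G. (u, v) \<in> nonadj G \<longleftrightarrow> (f u, f v) \<in> nonadj (with_proj H)"
    using assms digraph_iso_with_proj_iff_nonadj by blast
  show ?thesis
    unfolding sum.reindex_bij_betw[OF f(1), symmetric]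
    using card_nonadj_iso[OF f(1) _ f(2)] by simp
qed

end

section \<open>The extremal graphs\<close>

text \<open>The matching is the graph of \<open>mate\<close> below the largest even number not
  exceeding \<open>n\<close>; the pair containing \<open>i\<close> has index
  \<open>i div 2\<close>.\<close>

lemma mem_M_matching: "(i, j) \<in> M_matching n \<longleftrightarrow> i < 2 * (n div 2) \<and> j = mate i"
proof
  assume "i < 2 * (n div 2) \<and> j = mate i"
  then have "i div 2 < n div 2" "(i, j) \<in> {(2 * (i div 2), 2 * (i div 2) + 1), (2 * (i div 2) + 1, 2 * (i div 2))}"
    by (auto simp: mate_def elim!: oddE)
  then show "(i, j) \<in> M_matching n" unfolding M_matching_def by blast
qed (auto simp: M_matching_def mate_def)

lemma M_graph_wf: "parcs (M_graph n) \<subseteq> pverts (M_graph n) \<times> pverts (M_graph n)"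
    "irrefl (parcs (M_graph n))"
  by (auto simp: M_graph_def irrefl_def)

lemma mate_neq: "mate i \<noteq> i"
  by (auto simp: mate_def elim: oddE)

lemma mate_less: "i < 2 * m \<Longrightarrow> mate i < 2 * m"
  by (auto simp: mate_def elim!: evenE)

lemma nonadj_M_graph:
  assumes "n \<ge> 4"
  shows "nonadj (with_proj (M_graph n)) = M_matching n \<union> M_extra n"
proof -
  have "i < n \<and> j < n \<and> i \<noteq> j" if "(i, j) \<in> M_matching n" for i j
    using that mate_less[of i "n div 2"] mate_neq[of i] by (auto simp: mem_M_matching)
  moreover have "i < n \<and> j < n \<and> i \<noteq> j" if "(i, j) \<in> M_extra n" for i j
    using that assms by (auto simp: M_extra_def split: if_splits)
  ultimately show ?thesis by (auto simp: nonadj_def M_graph_def)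
qed

lemma card_nonadj_M_graph:
  assumes "n \<ge> 4"
  shows "card (nonadj (with_proj (M_graph n))) = n + n mod 2"
proof -
  have "M_matching n = (\<lambda>i. (i, mate i)) ` {..<2 * (n div 2)}"
    by (auto simp: mem_M_matching)
  then have 1: "finite (M_matching n)" "card (M_matching n) = 2 * (n div 2)"
    by (simp_all add: card_image inj_on_def)
  have 2: "card (M_extra n) = 2 * (n mod 2)" "finite (M_extra n)"
    using assms by (auto simp: M_extra_def odd_iff_mod_2_eq_one)
  \<comment> \<open>For odd \<open>n\<close> the vertex \<open>n - 1\<close> is unmatched, and the
    partner of 0 is 1, which differs from \<open>n - 1\<close>.\<close>
  have "M_matching n \<inter> M_extra n = {}"
    using assms by (auto simp: mem_M_matching M_extra_def elim!: oddE split: if_splits)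
  then have "card (M_matching n \<union> M_extra n) = 2 * (n div 2) + 2 * (n mod 2)"
    using 1 2 by (simp add: card_Un_disjoint)
  then show ?thesis unfolding nonadj_M_graph[OF assms] by presburger
qed

text \<open>Every vertex has a non-neighbour, its mate or, for the last vertex of an odd order, the
  vertex 0. Hence the loss is twice \<open>n + n mod 2 - n\<close>.\<close>

lemma sum_loss_M_graph:
  assumes "n \<ge> 4"
  shows "(\<Sum>i\<in>pverts (M_graph n). loss n (card (nonadj (with_proj (M_graph n)) `` {i})))
    = 2 * (int n mod 2)"
proof -
  let ?N = "nonadj (with_proj (M_graph n))"
  have V: "pverts (M_graph n) = {..<n}" by (simp add: M_graph_def)
  have sub: "?N \<subseteq> {..<n} \<times> {..<n}" by (auto simp: nonadj_def V)
  have "card (?N `` {i}) \<noteq> 0" if "i < n" for i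
  proof -
    have "\<exists>j. (i, j) \<in> ?N"
    proof (cases "i < 2 * (n div 2)")
      case True
      then show ?thesis using nonadj_M_graph[OF assms] mem_M_matching by auto
    next
      case False
      then have "odd n" "i = n - 1" using that by presburger+
      then show ?thesis using nonadj_M_graph[OF assms] by (auto simp: M_extra_def)
    qed
    moreover have "finite (?N `` {i})" by (rule finite_subset[of _ "{..<n}"]) (use sub in auto)
    ultimately show ?thesis by auto
  qed
  then have "(\<Sum>i<n. loss n (card (?N `` {i}))) = 2 * (int (card ?N) - int n)"
    using sum_loss_no_isolated[OF _ sub, of n] by simp
  then show ?thesis by (simp add: V card_nonadj_M_graph[OF assms] of_nat_mod)
qed

lemma H1_graph_wf: "parcs H1_graph \<subseteq> pverts H1_graph \<times> pverts H1_graph" "irrefl (parcs H1_graph)"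
  by (auto simp: H1_graph_def irrefl_def Let_def)

lemma lessThan_5: "{..<5::nat} = {0, 1, 2, 3, 4}"
  by auto

text \<open>The complement of the wheel consists of the two diagonals of the rim and the isolated
  hub.\<close>

lemma nonadj_H1_graph: "nonadj (with_proj H1_graph) = {(0, 2), (2, 0), (1, 3), (3, 1)}"
  by (auto simp: nonadj_def H1_graph_def Let_def lessThan_5)

lemma sum_loss_H1_graph:
  "(\<Sum>i\<in>pverts H1_graph. loss 5 (card (nonadj (with_proj H1_graph) `` {i}))) = 2"
proof -
  let ?N = "nonadj (with_proj H1_graph)"
  have "?N `` {0} = {2}" "?N `` {1} = {3}" "?N `` {2} = {0}" "?N `` {3} = {1}" "?N `` {4} = {}"
    unfolding nonadj_H1_graph by auto
  moreover have "pverts H1_graph = {0, 1, 2, 3, 4}" by (simp add: H1_graph_def Let_def lessThan_5)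
  ultimately show ?thesis by (simp add: loss_def)
qed

section \<open>Recognising the extremal graphs from their complements\<close>

context graph
begin

text \<open>For even \<open>n\<close> the relation \<open>M_extra n\<close> is empty and
  \<open>M_matching n\<close> covers all vertices.\<close>

lemma iso_M_graph_even:
  assumes "card (verts G) = n" "n \<ge> 4" "even n" "\<forall>v\<in>verts G. card (nonadj G `` {v}) = 1"
  shows "digraph_iso G (with_proj (M_graph n))"
proof -
  obtain f where f: "bij_betw f (verts G) {..<n}"
    "\<forall>u\<in>verts G. \<forall>v\<in>verts G. (u, v) \<in> nonadj G \<longleftrightarrow> f v = mate (f u)"
    using perfect_matching_enumeration(2)[OF finite_verts nonadj_subset sym_nonadj irrefl_nonadj assms(4)]
      assms(1) by metis
  have "f u < n" if "u \<in> verts G" for u using f(1) that by (auto simp: bij_betw_def)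
  then have "\<forall>u\<in>verts G. \<forall>v\<in>verts G. (u, v) \<in> nonadj G \<longleftrightarrow> (f u, f v) \<in> nonadj (with_proj (M_graph n))"
    using f(2) assms(3) by (auto simp: nonadj_M_graph[OF assms(2)] mem_M_matching M_extra_def)
  then show ?thesis
    using f(1) digraph_iso_with_proj_iff_nonadj[OF M_graph_wf] by (auto simp: M_graph_def)
qed

text \<open>
  Deleting one edge at the vertex with two non-neighbours from the complement leaves a perfect
  matching on the vertices other than the far end \<open>b\<close> of that edge.
\<close>

lemma iso_M_graph_odd:
  assumes "card (verts G) = n" "n \<ge> 4" "odd n" "z \<in> verts G" "card (nonadj G `` {z}) = 2"
    "\<forall>v\<in>verts G - {z}. card (nonadj G `` {v}) = 1"
  shows "digraph_iso G (with_proj (M_graph n))"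
proof -
  let ?N = "nonadj G"
  \<comment> \<open>\<open>a\<close> stays the partner of \<open>z\<close>, and \<open>b\<close> is
    the vertex to be cut off.\<close>
  obtain a b where ab: "?N `` {z} = {a, b}" "a \<noteq> b" using assms(5) by (auto simp: card_2_iff)
  have zb: "(z, b) \<in> ?N" "(b, z) \<in> ?N" using ab(1) sym_nonadj by (auto dest: symD)
  then have b: "b \<in> verts G" "b \<noteq> z" by (auto simp: nonadj_def)
  then have "card (?N `` {b}) = 1" using assms(6) by auto
  then have Nb: "?N `` {b} = {z}" using zb(2) by (metis Image_singleton_iff card_1_singletonE singletonD)
  define N' where "N' = ?N - {(z, b), (b, z)}"
  have sub: "N' \<subseteq> verts G \<times> verts G" using nonadj_subset by (auto simp: N'_def)
  have sym: "sym N'" using sym_nonadj by (auto simp: N'_def sym_def)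
  have irr: "irrefl N'" using irrefl_nonadj by (auto simp: N'_def irrefl_def)
  have Nb': "N' `` {b} = {}" using Nb by (auto simp: N'_def)
  have N1: "\<forall>v\<in>verts G - {b}. card (N' `` {v}) = 1"
  proof
    fix v assume v: "v \<in> verts G - {b}"
    show "card (N' `` {v}) = 1"
    proof (cases "v = z")
      case True
      then have "N' `` {v} = {a}" using ab b by (auto simp: N'_def)
      then show ?thesis by simp
    next
      case False
      then have "N' `` {v} = ?N `` {v}" using v by (auto simp: N'_def)
      then show ?thesis using assms(6) v False by auto
    qed
  qed
  \<comment> \<open>With \<open>z\<close> numbered 0 and \<open>b\<close> numbered
    \<open>n - 1\<close>, the deleted edge becomes the one in \<open>M_extra n\<close>.\<close>
  obtain f where f: "bij_betw f (verts G) {..<n}" "f b = n - 1" "f z = 0"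
    "\<forall>u\<in>verts G. \<forall>v\<in>verts G. (u, v) \<in> N' \<longleftrightarrow> u \<noteq> b \<and> v \<noteq> b \<and> f v = mate (f u)"
    using near_perfect_matching_enumeration[OF finite_verts sub sym irr b(1) Nb' N1, of z]
      assms(1,4) b(2) by auto
  have fn: "f u < n" if "u \<in> verts G" for u using f(1) that by (auto simp: bij_betw_def)
  have fb: "f u = n - 1 \<longleftrightarrow> u = b" "f u = 0 \<longleftrightarrow> u = z" if "u \<in> verts G" for u
    using f(1-3) that b assms(4) by (metis bij_betw_def inj_on_eq_iff)+
  \<comment> \<open>All numbers but the last are matched, which singles out
    \<open>b\<close>.\<close>
  have "2 * (n div 2) = n - 1" using assms(3) by presburger
  then have lt: "f u < 2 * (n div 2) \<longleftrightarrow> u \<noteq> b" if "u \<in> verts G" for u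
    using fn[OF that] fb(1)[OF that] by auto
  have "(u, v) \<in> ?N \<longleftrightarrow> (f u, f v) \<in> nonadj (with_proj (M_graph n))"
    if "u \<in> verts G" "v \<in> verts G" for u v
  proof -
    have "(u, v) \<in> N' \<longleftrightarrow> (f u, f v) \<in> M_matching n"
      using f(4) that lt[OF that(1)] lt[OF that(2)] mate_less[of "f u" "n div 2"]
      by (auto simp: mem_M_matching)
    moreover have "(u, v) \<in> {(z, b), (b, z)} \<longleftrightarrow> (f u, f v) \<in> M_extra n"
      using fb that assms(3) by (auto simp: M_extra_def)
    moreover have "?N = N' \<union> {(z, b), (b, z)}" using zb by (auto simp: N'_def)
    ultimately show ?thesis by (auto simp: nonadj_M_graph[OF assms(2)])
  qed
  then show ?thesis
    using f(1) digraph_iso_with_proj_iff_nonadj[OF M_graph_wf] by (auto simp: M_graph_def)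
qed

text \<open>The vertex without non-neighbours becomes the hub 4, and the matched pairs of the other
  four vertices become the diagonals of the rim.\<close>

lemma iso_H1_graph:
  assumes "card (verts G) = 5" "z \<in> verts G" "card (nonadj G `` {z}) = 0"
    "\<forall>v\<in>verts G - {z}. card (nonadj G `` {v}) = 1"
  shows "digraph_iso G (with_proj H1_graph)"
proof -
  let ?N = "nonadj G"
  have "finite (?N `` {z})" by (rule finite_subset[OF _ finite_verts]) (use nonadj_subset in auto)
  then have "?N `` {z} = {}" using assms(3) by simp
  then obtain f where f: "bij_betw f (verts G) {..<5}" "f z = 4"
    "\<forall>u\<in>verts G. \<forall>v\<in>verts G. (u, v) \<in> ?N \<longleftrightarrow> u \<noteq> z \<and> v \<noteq> z \<and> f v = mate (f u)"
    using near_perfect_matching_enumeration[OF finite_verts nonadj_subset sym_nonadj irrefl_nonadj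
        assms(2) _ assms(4), of z] assms(1) by auto
  \<comment> \<open>Opposite rim vertices of the wheel differ by 2, matched numbers by 1.\<close>
  let ?s = "transpose 1 (2::nat)"
  have "bij_betw ?s {..<5} {..<5}" by (simp add: lessThan_5 bij_betw_def transpose_def inj_on_def) auto
  then have bij: "bij_betw (?s \<circ> f) (verts G) {..<5}" using f(1) by (rule bij_betw_trans[rotated])
  have fb: "f u = 4 \<longleftrightarrow> u = z" "f u \<in> {0, 1, 2, 3, 4}" if "u \<in> verts G" for u
    using f(1,2) that assms(2) lessThan_5 by (metis bij_betw_def inj_on_eq_iff, metis bij_betwE)
  have "(u, v) \<in> ?N \<longleftrightarrow> ((?s \<circ> f) u, (?s \<circ> f) v) \<in> nonadj (with_proj H1_graph)"
    if "u \<in> verts G" "v \<in> verts G" for u v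
  proof -
    have "(i \<noteq> 4 \<and> j \<noteq> 4 \<and> j = mate i) \<longleftrightarrow> (?s i, ?s j) \<in> {(0, 2), (2, 0), (1, 3), (3, 1)}"
      if "i \<in> {0, 1, 2, 3, 4}" "j \<in> {0, 1, 2, 3, 4}" for i j
      using that by (auto simp: transpose_def mate_def)
    from this[OF fb(2) fb(2), OF that] show ?thesis
      using f(3) fb(1) that by (simp add: nonadj_H1_graph)
  qed
  then show ?thesis
    using bij digraph_iso_with_proj_iff_nonadj[OF H1_graph_wf]
    by (auto simp: H1_graph_def Let_def)
qed

end

theorem theorem3:
  fixes G :: "('a, 'b) pre_digraph" and n :: nat
  assumes "graph G"
    and "Digraph_Component.connected G"
    and "card (verts G) = n"
    and "n \<ge> 4"
    and "graph_diameter G = 2"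
  shows "int (eccentric_connectivity_index G)
           \<le> 2 * (int n)\<^sup>2 - 4 * int n - 2 * (int n mod 2)
       \<and> (int (eccentric_connectivity_index G)
             = 2 * (int n)\<^sup>2 - 4 * int n - 2 * (int n mod 2)
           \<longleftrightarrow> digraph_iso G (with_proj (M_graph n))
               \<or> (n = 5 \<and> digraph_iso G (with_proj H1_graph)))"
proof -
  interpret graph G by fact
  let ?L = "\<Sum>v\<in>verts G. loss n (card (nonadj G `` {v}))"
  \<comment> \<open>Both the bound and its equality case thereby become statements about the total
    loss \<open>?L\<close>.\<close>
  have eci: "int (eccentric_connectivity_index G) = 2 * (int n)\<^sup>2 - 4 * int n - ?L"
    by (rule eccentric_connectivity_index_eq_loss) (use assms in auto)
  note ext = sum_loss_extremal[OF finite_verts nonadj_subset sym_nonadj irrefl_nonadj assms(3,4)]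
  \<comment> \<open>The three shapes of the complement with minimal loss lead to
    \<open>M_graph\<close> of even order, \<open>M_graph\<close> of odd order and the wheel.\<close>
  have "digraph_iso G (with_proj (M_graph n)) \<or> (n = 5 \<and> digraph_iso G (with_proj H1_graph))"
    if "?L = 2 * (int n mod 2)"
    using ext(2)[OF that] iso_M_graph_even[OF assms(3,4)] iso_M_graph_odd[OF assms(3,4)]
      iso_H1_graph assms(3) by blast
  moreover have "?L = 2 * (int n mod 2)" if "digraph_iso G (with_proj (M_graph n))"
    using sum_loss_iso[OF that M_graph_wf] sum_loss_M_graph[OF assms(4)] by simp
  moreover have "?L = 2 * (int n mod 2)" if "n = 5" "digraph_iso G (with_proj H1_graph)"
    using sum_loss_iso[OF that(2) H1_graph_wf, of 5] sum_loss_H1_graph that(1) by simp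
  ultimately have "?L = 2 * (int n mod 2) \<longleftrightarrow> digraph_iso G (with_proj (M_graph n))
      \<or> (n = 5 \<and> digraph_iso G (with_proj H1_graph))"
    by blast
  moreover have "2 * (int n mod 2) \<le> ?L" by (rule ext(1))
  ultimately show ?thesis using eci by linarith
qed

end
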